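(* Consider a three-qubit system with Hamiltonian $H=H_1\otimes\mathbf{I}\otimes\mathbf{I}+\mathbf{I}\otimes H_2\otimes\mathbf{I}+\mathbf{I}\otimes\mathbf{I}\otimes H_3$, where $H_i=\sum_{j=0}^1(E_i+j\alpha_i)|j\rangle\langle j|$ with $E_i\in\mathbb{R}$ and $\alpha_i>0$ for $i\in\{1,2,3\}$. Let $\rho$ be a three-qubit state that is separable across the $1$-vs-$23$ bipartition, and let $\Delta_{1|23}=W(\rho)-W_{[1]}(\rho_1)-E(\rho_{23})+E_g^{23}$. Then: (a) if $\alpha_1<\alpha_2=\alpha_3$, then $\Delta_{1|23}\le 0$; (b) if $\alpha_1=\alpha_2=\alpha>\alpha_3$, then $\Delta_{1|23}\le\dfrac{\alpha-\alpha_3}{2}$.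
   Context: A state is a positive semidefinite trace-one operator; $\rho_1$ and $\rho_{23}$ are the reduced states of $\rho$ on qubit 1 and on qubits 2,3. $\rho$ is separable across $1$-vs-$23$ if it is a convex combination of product states $\sigma_1\otimes\tau_{23}$. The energy of a state $\sigma$ of a (sub)system with Hamiltonian $K$ is $E(\sigma)=\mathrm{Tr}[\sigma K]$. The ergotropy of $\sigma$ with respect to $K$ is $\mathrm{Tr}[\sigma K]-\min_U\mathrm{Tr}[U\sigma U^\dagger K]$, the minimum being over all unitaries $U$ on the corresponding Hilbert space. $W(\rho)$ is the ergotropy of $\rho$ with respect to $H$, $W_{[1]}(\rho_1)$ is the ergotropy of $\rho_1$ with respect to $H_1$, $E(\rho_{23})=\mathrm{Tr}[\rho_{23}(H_2\otimes\mathbf{I}+\mathbf{I}\otimes H_3)]$, and $E_g^{23}=E_2+E_3$ is the ground-state energy of $H_2\otimes\mathbf{I}+\mathbf{I}\otimes H_3$. *)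

theory Defs
  imports "HOL-Analysis.Analysis"
begin

(* Operators on a Hilbert space with orthonormal basis indexed by 'a are complex^'a^'a
   (outer index = row).  A composite system is indexed by the product type, so an operator on
   qubit 1 and the pair 2,3 has index type qubit * (qubit * qubit).
   False and True index the basis vectors |0> and |1>. *)
type_synonym 'a operator = "complex^'a^'a"
type_synonym qubit = bool

definition adj :: "complex^'a^'b \<Rightarrow> complex^'b^'a" where
  "adj A = (\<chi> i j. cnj (A $ j $ i))"

definition unitary :: "('a::finite) operator \<Rightarrow> bool" where
  "unitary U \<longleftrightarrow> adj U ** U = mat 1 \<and> U ** adj U = mat 1"

definition cinner :: "complex^'a::finite \<Rightarrow> complex^'a \<Rightarrow> complex" where
  "cinner v w = (\<Sum>i\<in>UNIV. cnj (v $ i) * w $ i)"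

definition pos_semidef :: "('a::finite) operator \<Rightarrow> bool" where
  "pos_semidef A \<longleftrightarrow> adj A = A \<and> (\<forall>v. 0 \<le> Re (cinner v (A *v v)))"

definition is_state :: "('a::finite) operator \<Rightarrow> bool" where
  "is_state A \<longleftrightarrow> pos_semidef A \<and> trace A = 1"

definition tensor :: "('a::finite) operator \<Rightarrow> ('b::finite) operator \<Rightarrow> ('a \<times> 'b) operator"
    (infixr \<open>\<otimes>\<close> 70) where
  "A \<otimes> B = (\<chi> r c. A $ fst r $ fst c * B $ snd r $ snd c)"

definition reduced_fst :: "('a::finite \<times> 'b::finite) operator \<Rightarrow> 'a operator" where
  "reduced_fst \<rho> = (\<chi> i j. \<Sum>k\<in>UNIV. \<rho> $ (i, k) $ (j, k))"

definition reduced_snd :: "('a::finite \<times> 'b::finite) operator \<Rightarrow> 'b operator" where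
  "reduced_snd \<rho> = (\<chi> k l. \<Sum>i\<in>UNIV. \<rho> $ (i, k) $ (i, l))"

definition separable :: "('a::finite \<times> 'b::finite) operator \<Rightarrow> bool" where
  "separable \<rho> \<longleftrightarrow> \<rho> \<in> convex hull {\<sigma> \<otimes> \<tau> | \<sigma> \<tau>. is_state \<sigma> \<and> is_state \<tau>}"

(* The trace is real whenever both arguments are Hermitian. *)
definition energy :: "('a::finite) operator \<Rightarrow> 'a operator \<Rightarrow> real" where
  "energy \<sigma> K = Re (trace (\<sigma> ** K))"

(* The infimum is attained, see ergotropy_min_attained. *)
definition ergotropy :: "('a::finite) operator \<Rightarrow> 'a operator \<Rightarrow> real" where
  "ergotropy \<sigma> K = energy \<sigma> K - (INF U\<in>{U. unitary U}. energy (U ** \<sigma> ** adj U) K)"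

(* Least eigenvalue; meant for Hermitian K, whose eigenvalues are real. *)
definition ground_energy :: "('a::finite) operator \<Rightarrow> real" where
  "ground_energy K = Min {e. \<exists>v. v \<noteq> 0 \<and> K *v v = complex_of_real e *s v}"

definition basis_proj :: "'a \<Rightarrow> ('a::finite) operator" where
  "basis_proj j = (\<chi> r c. if r = j \<and> c = j then 1 else 0)"

definition qubit_ham :: "real \<Rightarrow> real \<Rightarrow> qubit operator" where
  "qubit_ham E \<alpha> = (\<Sum>j\<in>UNIV. (E + of_bool j * \<alpha>) *\<^sub>R basis_proj j)"

definition ham2 :: "('a::finite) operator \<Rightarrow> ('b::finite) operator \<Rightarrow> ('a \<times> 'b) operator" where
  "ham2 K L = K \<otimes> mat 1 + mat 1 \<otimes> L"

definition ham3 :: "('a::finite) operator \<Rightarrow> ('b::finite) operator \<Rightarrow> ('c::finite) operator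
    \<Rightarrow> ('a \<times> 'b \<times> 'c) operator" where
  "ham3 K L M = K \<otimes> mat 1 \<otimes> mat 1 + mat 1 \<otimes> L \<otimes> mat 1 + mat 1 \<otimes> mat 1 \<otimes> M"

definition Delta_1_23 :: "('a::finite) operator \<Rightarrow> ('b::finite) operator \<Rightarrow> ('c::finite) operator
    \<Rightarrow> ('a \<times> 'b \<times> 'c) operator \<Rightarrow> real" where
  "Delta_1_23 H1 H2 H3 \<rho> =
     ergotropy \<rho> (ham3 H1 H2 H3) - ergotropy (reduced_fst \<rho>) H1
     - energy (reduced_snd \<rho>) (ham2 H2 H3) + ground_energy (ham2 H2 H3)"

lemma closed_unitary: "closed {U :: ('a::finite) operator. unitary U}"
proof -
  have "continuous_on UNIV (\<lambda>U :: 'a operator. adj U ** U)"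
       "continuous_on UNIV (\<lambda>U :: 'a operator. U ** adj U)"
    unfolding adj_def matrix_matrix_mult_def by (intro continuous_intros; simp)+
  then show ?thesis
    unfolding unitary_def by (intro closed_Collect_conj closed_Collect_eq continuous_on_const)
qed

lemma norm_unitary_entry:
  assumes "unitary (U :: ('a::finite) operator)"
  shows "norm (U $ i $ j) \<le> 1"
proof -
  have "(\<Sum>k\<in>UNIV. (norm (U $ i $ k))\<^sup>2) = Re ((U ** adj U) $ i $ i)"
    by (simp add: matrix_matrix_mult_def adj_def complex_mult_cnj cmod_power2)
  also have "\<dots> = 1" using assms by (simp add: unitary_def mat_def)
  finally have "(norm (U $ i $ j))\<^sup>2 \<le> 1"
    using member_le_sum[of j UNIV "\<lambda>k. (norm (U $ i $ k))\<^sup>2"] by simp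
  then show ?thesis by (simp add: power_le_one_iff abs_square_le_1)
qed

lemma compact_unitary: "compact {U :: ('a::finite) operator. unitary U}"
proof -
  have "norm U \<le> of_nat CARD('a) * of_nat CARD('a)" if "unitary U" for U :: "'a operator"
  proof -
    have "norm (U $ i) \<le> of_nat CARD('a)" for i
    proof -
      have "norm (U $ i) \<le> (\<Sum>j\<in>UNIV. norm (U $ i $ j))"
        unfolding norm_vec_def by (rule L2_set_le_sum) simp
      also have "\<dots> \<le> of_nat CARD('a) * 1"
        by (rule sum_bounded_above) (simp add: norm_unitary_entry that)
      finally show ?thesis by simp
    qed
    moreover have "norm U \<le> (\<Sum>i\<in>UNIV. norm (U $ i))"
      unfolding norm_vec_def[of U] by (rule L2_set_le_sum) simp
    ultimately show ?thesis
      by (smt (verit) sum_bounded_above)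
  qed
  then have "bounded {U :: 'a operator. unitary U}" unfolding bounded_iff by blast
  then show ?thesis using closed_unitary compact_eq_bounded_closed by blast
qed

lemma ergotropy_min_attained:
  fixes \<sigma> K :: "('a::finite) operator"
  obtains V where "unitary V"
    "\<And>U. unitary U \<Longrightarrow> energy (V ** \<sigma> ** adj V) K \<le> energy (U ** \<sigma> ** adj U) K"
    "ergotropy \<sigma> K = energy \<sigma> K - energy (V ** \<sigma> ** adj V) K"
proof -
  have "continuous_on UNIV (\<lambda>U :: 'a operator. energy (U ** \<sigma> ** adj U) K)"
    unfolding energy_def trace_def adj_def matrix_matrix_mult_def
    by (simp, intro continuous_intros)
  then have cont: "continuous_on {U. unitary U} (\<lambda>U. energy (U ** \<sigma> ** adj U) K)"
    by (rule continuous_on_subset) simp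
  have "adj (mat 1 :: 'a operator) = mat 1" by (simp add: adj_def mat_def vec_eq_iff)
  then have "unitary (mat 1 :: 'a operator)" by (simp add: unitary_def)
  then have "{U :: 'a operator. unitary U} \<noteq> {}" by blast
  from continuous_attains_inf[OF compact_unitary this cont]
  obtain V where V: "unitary V"
    "\<And>U. unitary U \<Longrightarrow> energy (V ** \<sigma> ** adj V) K \<le> energy (U ** \<sigma> ** adj U) K" by auto
  then have "(INF U\<in>{U. unitary U}. energy (U ** \<sigma> ** adj U) K) = energy (V ** \<sigma> ** adj V) K"
    by (intro cInf_eq_minimum) auto
  with V show ?thesis by (intro that) (auto simp: ergotropy_def)
qed

lemma qubit_ham_nth:
  "qubit_ham E \<alpha> $ r $ c = (if r = c then complex_of_real (E + of_bool r * \<alpha>) else 0)"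
  by (cases r; cases c) (simp_all add: qubit_ham_def basis_proj_def UNIV_bool
      scaleR_conv_of_real[where 'a = complex])

lemma ham2_mult_nth:
  "(ham2 (qubit_ham E2 \<alpha>2) (qubit_ham E3 \<alpha>3) *v v) $ r =
     complex_of_real (E2 + E3 + of_bool (fst r) * \<alpha>2 + of_bool (snd r) * \<alpha>3) * v $ r"
proof -
  have "ham2 (qubit_ham E2 \<alpha>2) (qubit_ham E3 \<alpha>3) $ r $ c =
     (if c = r then complex_of_real (E2 + E3 + of_bool (fst r) * \<alpha>2 + of_bool (snd r) * \<alpha>3) else 0)"
    for c
    by (cases r; cases c) (auto simp: ham2_def tensor_def qubit_ham_nth mat_def)
  then have "(ham2 (qubit_ham E2 \<alpha>2) (qubit_ham E3 \<alpha>3) *v v) $ r = (\<Sum>c\<in>UNIV. if c = r then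
     complex_of_real (E2 + E3 + of_bool (fst r) * \<alpha>2 + of_bool (snd r) * \<alpha>3) * v $ c else 0)"
    unfolding matrix_vector_mult_def vec_lambda_beta by (intro sum.cong) auto
  then show ?thesis by (simp only: sum.delta' sum.delta finite UNIV_I if_True)
qed

lemma ground_energy_ham2:
  assumes "\<alpha>2 > 0" "\<alpha>3 > 0"
  shows "ground_energy (ham2 (qubit_ham E2 \<alpha>2) (qubit_ham E3 \<alpha>3)) = E2 + E3"
proof -
  let ?K = "ham2 (qubit_ham E2 \<alpha>2) (qubit_ham E3 \<alpha>3)"
  let ?e = "\<lambda>r. E2 + E3 + of_bool (fst r) * \<alpha>2 + of_bool (snd r) * \<alpha>3"
  have "{e. \<exists>v. v \<noteq> 0 \<and> ?K *v v = complex_of_real e *s v} = range ?e"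
  proof (intro equalityI subsetI)
    fix e assume "e \<in> {e. \<exists>v. v \<noteq> 0 \<and> ?K *v v = complex_of_real e *s v}"
    then obtain v where v: "v \<noteq> 0" "?K *v v = complex_of_real e *s v" by blast
    then obtain r where r: "v $ r \<noteq> 0" by (auto simp: vec_eq_iff)
    from v(2) have "(?K *v v) $ r = complex_of_real e * v $ r" by simp
    then have "complex_of_real (?e r) * v $ r = complex_of_real e * v $ r"
      unfolding ham2_mult_nth .
    then have "complex_of_real (?e r) = complex_of_real e"
      using mult_right_cancel[OF r] by blast
    then have "e = ?e r" by (simp only: of_real_eq_iff)
    then show "e \<in> range ?e" by blast
  next
    fix e assume "e \<in> range ?e"
    then obtain r where r: "e = ?e r" by blast
    have "?K *v axis r 1 = complex_of_real e *s axis r 1"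
    proof (subst vec_eq_iff, rule allI)
      fix s
      show "(?K *v axis r 1) $ s = (complex_of_real e *s axis r 1) $ s"
        unfolding ham2_mult_nth vector_smult_component r by (cases "s = r") (auto simp: axis_def)
    qed
    moreover have "axis r (1::complex) \<noteq> 0" by (simp add: axis_eq_0_iff)
    ultimately show "e \<in> {e. \<exists>v. v \<noteq> 0 \<and> ?K *v v = complex_of_real e *s v}" by blast
  qed
  moreover have "Min (range ?e) = E2 + E3"
  proof (rule Min_eqI)
    show "E2 + E3 \<in> range ?e" by (rule range_eqI[of _ _ "(False, False)"]) simp
  qed (use assms in auto)
  ultimately show ?thesis by (simp add: ground_energy_def)
qed

end

theory Submission
  imports Defs
begin

text \<open>Energies are additive over marginals, so \<open>\<Delta>\<close> equals \<open>\<alpha>\<^sub>1 m\<close> minus the least excitation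
  energy of \<open>U \<rho> U\<^sup>*\<close>, where \<open>m\<close> is the smaller eigenvalue of \<open>\<rho>\<^sub>1\<close>. Separability gives
  \<open>\<rho> \<le> \<rho>\<^sub>1 \<otimes> 1\<close>, so every population \<open>d\<^sub>r\<close> of \<open>U \<rho> U\<^sup>*\<close> is at most \<open>1 - m\<close>. In case (a) every
  excited level costs at least \<open>\<alpha>\<^sub>1\<close>, so the excitation energy is at least
  \<open>\<alpha>\<^sub>1 (1 - d\<^sub>0\<^sub>0\<^sub>0) \<ge> \<alpha>\<^sub>1 m\<close>. In case (b) the only cheaper level is \<open>001\<close>; this leaves the error
  \<open>(\<alpha> - \<alpha>\<^sub>3) min d\<^sub>0\<^sub>0\<^sub>0 d\<^sub>0\<^sub>0\<^sub>1\<close>, and the minimum of two populations is at most \<open>1/2\<close>.\<close>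

section \<open>Quadratic forms and the Cauchy-Schwarz inequality for semidefinite operators\<close>

definition expect :: "('a::finite) operator \<Rightarrow> complex^'a \<Rightarrow> real" where
  "expect A v = Re (cinner v (A *v v))"

text \<open>These are the coefficients of \<open>u\<close> over the basis of the second factor, so
  summing \<open>expect A (slice u k)\<close> over \<open>k\<close> gives the expectation of
  \<open>A \<otimes> mat 1\<close> in \<open>u\<close>.\<close>

definition slice :: "complex^('a::finite \<times> 'b::finite) \<Rightarrow> 'b \<Rightarrow> complex^'a" where
  "slice u k = (\<chi> i. u $ (i, k))"

lemma sum_prod_UNIV:
  "(\<Sum>r\<in>UNIV. f r) = (\<Sum>i\<in>UNIV. \<Sum>k\<in>UNIV. f (i, k))"
  by (simp add: sum.cartesian_product flip: UNIV_Times_UNIV)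

lemma cinner_form_sum:
  "cinner v (A *v w) = (\<Sum>i\<in>UNIV. \<Sum>j\<in>UNIV. cnj (v $ i) * A $ i $ j * w $ j)"
  by (simp add: cinner_def matrix_vector_mult_def sum_distrib_left mult.assoc)

lemma cinner_add_left: "cinner (u + v) w = cinner u w + cinner v w"
  by (simp add: cinner_def sum.distrib algebra_simps)

lemma cinner_add_right: "cinner u (v + w) = cinner u v + cinner u w"
  by (simp add: cinner_def sum.distrib algebra_simps)

lemma cinner_scale_left: "cinner (a *s v) w = cnj a * cinner v w"
  by (simp add: cinner_def sum_distrib_left algebra_simps)

lemma cinner_scale_right: "cinner v (a *s w) = a * cinner v w"
  by (simp add: cinner_def sum_distrib_left algebra_simps)

lemma hermitian_nth: "adj A = A \<Longrightarrow> cnj (A $ j $ i) = A $ i $ j"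
  by (simp add: vec_eq_iff adj_def)

lemma hermitian_form_cnj:
  assumes "adj A = A"
  shows "cinner w (A *v v) = cnj (cinner v (A *v w))"
proof -
  have "cnj (cinner v (A *v w)) = (\<Sum>i\<in>UNIV. \<Sum>j\<in>UNIV. cnj (w $ j) * A $ j $ i * v $ i)"
    by (simp add: cinner_form_sum hermitian_nth[OF assms] algebra_simps)
  also have "\<dots> = cinner w (A *v v)"
    unfolding cinner_form_sum by (rule sum.swap)
  finally show ?thesis ..
qed

text \<open>The form is nonnegative at every \<open>v + t *s w\<close>. It may be degenerate, hence
  the separate case of a null \<open>w\<close>.\<close>

lemma pos_semidef_cauchy_schwarz:
  assumes "pos_semidef A"
  shows "cmod (cinner v (A *v w)) \<le> sqrt (expect A v) * sqrt (expect A w)"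
proof -
  let ?b = "cinner v (A *v w)" and ?c = "expect A w"
  have herm: "adj A = A" and nonneg: "\<And>u. 0 \<le> expect A u"
    using assms by (auto simp: pos_semidef_def expect_def)
  have quad: "2 * s * (cmod ?b)\<^sup>2 \<le> expect A v + s\<^sup>2 * (cmod ?b)\<^sup>2 * ?c" for s :: real
  proof -
    \<comment> \<open>This phase makes both cross terms real and equal, leaving a quadratic in the
      real \<open>s\<close>.\<close>
    define t where "t = - (complex_of_real s * cnj ?b)"
    have tb: "t * ?b = - complex_of_real (s * (cmod ?b)\<^sup>2)"
      by (simp add: t_def complex_norm_square del: of_real_power)
    have tt: "cnj t * t = complex_of_real (s\<^sup>2 * (cmod ?b)\<^sup>2)"
      by (simp add: t_def complex_norm_square power2_eq_square[of s] del: of_real_power)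
    have "cinner (v + t *s w) (A *v (v + t *s w))
        = cinner v (A *v v) + t * ?b + cnj (t * ?b) + cnj t * t * cinner w (A *v w)"
      by (simp add: matrix_vector_right_distrib vector_scalar_commute cinner_add_left
          cinner_add_right cinner_scale_left cinner_scale_right
          hermitian_form_cnj[OF herm, of w v] algebra_simps)
    then have "expect A (v + t *s w) = expect A v - 2 * s * (cmod ?b)\<^sup>2 + s\<^sup>2 * (cmod ?b)\<^sup>2 * ?c"
      unfolding expect_def tb tt by simp
    with nonneg[of "v + t *s w"] show ?thesis by simp
  qed
  have "(cmod ?b)\<^sup>2 \<le> expect A v * ?c"
  proof (cases "?c = 0")
    case True
    have "(cmod ?b)\<^sup>2 = 0"
    proof (rule ccontr)
      assume b: "(cmod ?b)\<^sup>2 \<noteq> 0"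
      show False
        \<comment> \<open>With \<open>?c = 0\<close> the bound is linear in \<open>s\<close>; this
          \<open>s\<close> turns it into \<open>expect A v + 1 \<le> expect A v\<close>.\<close>
        using quad[of "(expect A v + 1) / (2 * (cmod ?b)\<^sup>2)"] True b by simp
    qed
    then show ?thesis using True by simp
  next
    case False
    then have "0 < ?c" using nonneg[of w] by simp
    then show ?thesis
      \<comment> \<open>The quadratic is smallest at \<open>s = 1 / ?c\<close>.\<close>
      using quad[of "1 / ?c"] by (simp add: field_simps power2_eq_square)
  qed
  then show ?thesis
    by (metis real_le_rsqrt real_sqrt_mult)
qed

section \<open>Domination of product and separable states by their first marginal\<close>

lemma cinner_axis_left: "cinner (axis k 1) w = w $ k"
  by (simp add: cinner_def axis_def if_distrib[of cnj] if_distrib[of "\<lambda>x. x * _"] cong: if_cong)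

lemma cinner_axis: "cinner (axis k 1) (A *v axis l 1) = A $ k $ l"
  unfolding cinner_axis_left
  by (simp add: matrix_vector_mult_def axis_def if_distrib[of "\<lambda>x. _ * x"] cong: if_cong)

lemma expect_axis: "expect A (axis k 1) = Re (A $ k $ k)"
  by (simp add: expect_def cinner_axis)

lemma pos_semidef_diag_nonneg: "pos_semidef A \<Longrightarrow> 0 \<le> Re (A $ k $ k)"
  by (metis expect_axis expect_def pos_semidef_def)

text \<open>Expanding \<open>u\<close> in slices separates the entries of \<open>\<tau>\<close> from
  the \<open>\<sigma>\<close>-Gram matrix of the slices, so that each can be bounded on its
  own.\<close>

lemma expect_tensor:
  "expect (\<sigma> \<otimes> \<tau>) u =
     Re (\<Sum>k\<in>UNIV. \<Sum>l\<in>UNIV. \<tau> $ k $ l * cinner (slice u k) (\<sigma> *v slice u l))"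
proof -
  have "cinner u ((\<sigma> \<otimes> \<tau>) *v u) = (\<Sum>i\<in>UNIV. \<Sum>k\<in>UNIV. \<Sum>j\<in>UNIV. \<Sum>l\<in>UNIV.
      cnj (u $ (i, k)) * (\<sigma> $ i $ j * \<tau> $ k $ l) * u $ (j, l))"
    by (simp add: cinner_form_sum sum_prod_UNIV tensor_def)
  also have "\<dots> = (\<Sum>k\<in>UNIV. \<Sum>i\<in>UNIV. \<Sum>j\<in>UNIV. \<Sum>l\<in>UNIV.
      cnj (u $ (i, k)) * (\<sigma> $ i $ j * \<tau> $ k $ l) * u $ (j, l))"
    by (rule sum.swap)
  also have "\<dots> = (\<Sum>k\<in>UNIV. \<Sum>i\<in>UNIV. \<Sum>l\<in>UNIV. \<Sum>j\<in>UNIV.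
      cnj (u $ (i, k)) * (\<sigma> $ i $ j * \<tau> $ k $ l) * u $ (j, l))"
    by (rule sum.cong[OF refl], rule sum.cong[OF refl], rule sum.swap)
  also have "\<dots> = (\<Sum>k\<in>UNIV. \<Sum>l\<in>UNIV. \<Sum>i\<in>UNIV. \<Sum>j\<in>UNIV.
      cnj (u $ (i, k)) * (\<sigma> $ i $ j * \<tau> $ k $ l) * u $ (j, l))"
    by (rule sum.cong[OF refl], rule sum.swap)
  also have "\<dots> = (\<Sum>k\<in>UNIV. \<Sum>l\<in>UNIV. \<tau> $ k $ l * cinner (slice u k) (\<sigma> *v slice u l))"
    by (simp add: cinner_form_sum slice_def sum_distrib_left algebra_simps)
  finally show ?thesis by (simp add: expect_def)
qed

text \<open>Bounding the entries of \<open>\<tau>\<close> and of the Gram matrix of the slices by their diagonals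
  avoids the spectral theorem.\<close>
lemma expect_tensor_le:
  assumes "pos_semidef \<sigma>" "is_state \<tau>"
  shows "expect (\<sigma> \<otimes> \<tau>) u \<le> (\<Sum>k\<in>UNIV. expect \<sigma> (slice u k))"
proof -
  let ?m = "\<lambda>k. expect \<sigma> (slice u k)" and ?t = "\<lambda>k. Re (\<tau> $ k $ k)"
  let ?g = "\<lambda>k. sqrt (?t k) * sqrt (?m k)"
  have \<tau>: "pos_semidef \<tau>" and tr: "trace \<tau> = 1" using assms(2) by (auto simp: is_state_def)
  have m0: "0 \<le> ?m k" for k using assms(1) by (simp add: pos_semidef_def expect_def)
  have t0: "0 \<le> ?t k" for k using pos_semidef_diag_nonneg[OF \<tau>] .
  have "expect (\<sigma> \<otimes> \<tau>) u
      = (\<Sum>k\<in>UNIV. \<Sum>l\<in>UNIV. Re (\<tau> $ k $ l * cinner (slice u k) (\<sigma> *v slice u l)))"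
    by (simp only: expect_tensor Re_sum)
  also have "\<dots> \<le> (\<Sum>k\<in>UNIV. \<Sum>l\<in>UNIV. ?g k * ?g l)"
  proof (intro sum_mono)
    fix k l
    have "Re (\<tau> $ k $ l * cinner (slice u k) (\<sigma> *v slice u l))
        \<le> cmod (\<tau> $ k $ l) * cmod (cinner (slice u k) (\<sigma> *v slice u l))"
      using complex_Re_le_cmod by (metis norm_mult)
    also have "\<dots> \<le> (sqrt (?t k) * sqrt (?t l)) * (sqrt (?m k) * sqrt (?m l))"
      using pos_semidef_cauchy_schwarz[OF \<tau>, of "axis k 1" "axis l 1"]
        pos_semidef_cauchy_schwarz[OF assms(1), of "slice u k" "slice u l"] t0
      by (intro mult_mono) (simp_all add: cinner_axis expect_axis)
    finally show "Re (\<tau> $ k $ l * cinner (slice u k) (\<sigma> *v slice u l)) \<le> ?g k * ?g l"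
      by (simp add: algebra_simps)
  qed
  also have "\<dots> = (\<Sum>k\<in>UNIV. ?g k)\<^sup>2"
    by (simp only: power2_eq_square sum_product)
  \<comment> \<open>A second Cauchy-Schwarz, now over \<open>k\<close>, splits off the trace of
    \<open>\<tau>\<close>, which is 1.\<close>
  also have "\<dots> \<le> (\<Sum>k\<in>UNIV. (sqrt (?t k))\<^sup>2) * (\<Sum>k\<in>UNIV. (sqrt (?m k))\<^sup>2)"
    by (rule Cauchy_Schwarz_ineq_sum)
  also have "\<dots> = (\<Sum>k\<in>UNIV. ?t k) * (\<Sum>k\<in>UNIV. ?m k)" using m0 t0 by simp
  also have "(\<Sum>k\<in>UNIV. ?t k) = 1" using tr by (metis trace_def Re_sum one_complex.sel(1))
  finally show ?thesis by simp
qed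

lemma reduced_fst_tensor: "trace \<tau> = 1 \<Longrightarrow> reduced_fst (\<sigma> \<otimes> \<tau>) = \<sigma>"
  by (simp add: vec_eq_iff reduced_fst_def tensor_def trace_def flip: sum_distrib_left)

lemma expect_linear:
  "expect (a *\<^sub>R A + b *\<^sub>R B) v = a * expect A v + b * expect B v"
proof -
  have "cinner v ((a *\<^sub>R A + b *\<^sub>R B) *v v)
      = complex_of_real a * cinner v (A *v v) + complex_of_real b * cinner v (B *v v)"
    unfolding cinner_form_sum
    by (simp add: scaleR_conv_of_real[where 'a = complex] sum.distrib sum_distrib_left algebra_simps)
  then show ?thesis by (simp add: expect_def)
qed

lemma reduced_fst_linear:
  "reduced_fst (a *\<^sub>R A + b *\<^sub>R B) = a *\<^sub>R reduced_fst A + b *\<^sub>R reduced_fst B"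
  by (simp add: vec_eq_iff reduced_fst_def sum.distrib scaleR_sum_right)

text \<open>The operator inequality \<open>\<rho> \<le> \<rho>\<^sub>1 \<otimes> 1\<close>.\<close>
lemma separable_expect_le:
  assumes "separable \<rho>"
  shows "expect \<rho> u \<le> (\<Sum>k\<in>UNIV. expect (reduced_fst \<rho>) (slice u k))"
proof -
  let ?C = "{\<rho>. expect \<rho> u \<le> (\<Sum>k\<in>UNIV. expect (reduced_fst \<rho>) (slice u k))}"
  \<comment> \<open>Both sides of the inequality are real-linear in the state, so product states
    suffice.\<close>
  have "convex ?C"
  proof (rule convexI)
    fix A B and a b :: real
    assume "A \<in> ?C" "B \<in> ?C" "0 \<le> a" "0 \<le> b"
    then show "a *\<^sub>R A + b *\<^sub>R B \<in> ?C"
      by (simp add: expect_linear reduced_fst_linear sum.distrib add_mono mult_left_mono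
          flip: sum_distrib_left)
  qed
  moreover have "{\<sigma> \<otimes> \<tau> | \<sigma> \<tau>. is_state \<sigma> \<and> is_state \<tau>} \<subseteq> ?C"
    using expect_tensor_le by (fastforce simp: is_state_def reduced_fst_tensor)
  ultimately have "convex hull {\<sigma> \<otimes> \<tau> | \<sigma> \<tau>. is_state \<sigma> \<and> is_state \<tau>} \<subseteq> ?C"
    by (rule hull_minimal[rotated])
  then show ?thesis using assms by (auto simp: separable_def)
qed

section \<open>Populations under unitary conjugation, and energies\<close>

lemma conj_unitary_diag:
  "Re ((U ** A ** adj U) $ r $ r) = expect A (\<chi> i. cnj (U $ r $ i))"
proof -
  \<comment> \<open>The vector on the right is \<open>adj U *v axis r 1\<close>.\<close>
  have "(U ** A ** adj U) $ r $ r = (\<Sum>j\<in>UNIV. \<Sum>i\<in>UNIV. U $ r $ i * A $ i $ j * cnj (U $ r $ j))"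
    by (simp add: matrix_matrix_mult_def adj_def sum_distrib_right)
  then show ?thesis
    by (subst (asm) sum.swap) (simp add: expect_def cinner_form_sum)
qed

lemma unitary_row_norm:
  assumes "unitary U"
  shows "(\<Sum>i\<in>UNIV. (cmod (U $ r $ i))\<^sup>2) = 1"
proof -
  have "complex_of_real (\<Sum>i\<in>UNIV. (cmod (U $ r $ i))\<^sup>2) = (U ** adj U) $ r $ r"
    by (simp add: matrix_matrix_mult_def adj_def complex_norm_square del: of_real_power)
  also have "\<dots> = complex_of_real 1" using assms by (simp add: unitary_def mat_def)
  finally show ?thesis by (simp only: of_real_eq_iff)
qed

lemma trace_conj_unitary:
  assumes "unitary U"
  shows "trace (U ** A ** adj U) = trace A"
  using assms by (metis matrix_mul_assoc trace_mul_sym matrix_mul_lid unitary_def)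

lemma energy_diag:
  assumes "\<And>r c. K $ r $ c = (if r = c then complex_of_real (h r) else 0)"
  shows "energy A K = (\<Sum>r\<in>UNIV. Re (A $ r $ r) * h r)"
  by (simp add: energy_def trace_def matrix_matrix_mult_def assms if_distrib sum.delta
      sum.delta' cong: if_cong)

text \<open>Trace one eliminates the ground population; for positive \<open>\<alpha>\<close>,
  minimizing energy thus means minimizing the excited population.\<close>

lemma energy_qubit_ham:
  assumes "trace A = 1"
  shows "energy A (qubit_ham E \<alpha>) = E + \<alpha> * Re (A $ True $ True)"
proof -
  have F: "Re (A $ False $ False) = 1 - Re (A $ True $ True)"
    using arg_cong[OF assms, of Re] by (simp add: trace_def UNIV_bool)
  show ?thesis
    by (simp add: energy_diag[OF qubit_ham_nth] UNIV_bool F algebra_simps)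
qed

lemma tensor_mat_1: "mat 1 \<otimes> mat 1 = mat 1"
  by (simp add: vec_eq_iff tensor_def mat_def prod_eq_iff)

lemma tensor_add_right: "A \<otimes> (B + C) = A \<otimes> B + A \<otimes> C"
  by (simp add: vec_eq_iff tensor_def distrib_left)

lemma ham3_eq_ham2: "ham3 K L M = ham2 K (ham2 L M)"
  by (simp add: ham3_def ham2_def tensor_mat_1 tensor_add_right add.assoc)

lemma ham2_diag:
  assumes "\<And>r c. K $ r $ c = (if r = c then complex_of_real (f r) else 0)"
    and "\<And>r c. L $ r $ c = (if r = c then complex_of_real (g r) else 0)"
  shows "ham2 K L $ r $ c = (if r = c then complex_of_real (f (fst r) + g (snd r)) else 0)"
  by (cases r; cases c) (auto simp: ham2_def tensor_def mat_def assms)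

text \<open>The identity factor forces equal indices, which is a partial trace. This cancels the
  initial energies in \<open>Delta_1_23\<close>.\<close>

lemma energy_ham2:
  "energy \<rho> (ham2 K L) = energy (reduced_fst \<rho>) K + energy (reduced_snd \<rho>) L"
proof -
  have 1: "trace (\<rho> ** (K \<otimes> mat 1)) = trace (reduced_fst \<rho> ** K)"
  proof -
    have "trace (\<rho> ** (K \<otimes> mat 1)) = (\<Sum>i\<in>UNIV. \<Sum>k\<in>UNIV. \<Sum>j\<in>UNIV. \<Sum>l\<in>UNIV.
        if l = k then \<rho> $ (i, k) $ (j, l) * K $ j $ i else 0)"
      unfolding trace_def matrix_matrix_mult_def sum_prod_UNIV tensor_def mat_def
      by (simp add: mult_delta_left mult_delta_right)
    also have "\<dots> = (\<Sum>i\<in>UNIV. \<Sum>k\<in>UNIV. \<Sum>j\<in>UNIV. \<rho> $ (i, k) $ (j, k) * K $ j $ i)"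
      by simp
    also have "\<dots> = trace (reduced_fst \<rho> ** K)"
      by (simp add: trace_def matrix_matrix_mult_def reduced_fst_def sum_distrib_right,
          rule sum.cong[OF refl], rule sum.swap)
    finally show ?thesis .
  qed
  have 2: "trace (\<rho> ** (mat 1 \<otimes> L)) = trace (reduced_snd \<rho> ** L)"
  proof -
    have "trace (\<rho> ** (mat 1 \<otimes> L)) = (\<Sum>i\<in>UNIV. \<Sum>k\<in>UNIV. \<Sum>j\<in>UNIV. \<Sum>l\<in>UNIV.
        if j = i then \<rho> $ (i, k) $ (j, l) * L $ l $ k else 0)"
      unfolding trace_def matrix_matrix_mult_def sum_prod_UNIV tensor_def mat_def
      by (simp add: mult_delta_left mult_delta_right cong: if_cong)
    also have "\<dots> = (\<Sum>i\<in>UNIV. \<Sum>k\<in>UNIV. \<Sum>l\<in>UNIV. \<Sum>j\<in>UNIV.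
        if j = i then \<rho> $ (i, k) $ (j, l) * L $ l $ k else 0)"
      by (rule sum.cong[OF refl], rule sum.cong[OF refl], rule sum.swap)
    also have "\<dots> = (\<Sum>i\<in>UNIV. \<Sum>k\<in>UNIV. \<Sum>l\<in>UNIV. \<rho> $ (i, k) $ (i, l) * L $ l $ k)"
      by simp
    also have "\<dots> = (\<Sum>k\<in>UNIV. \<Sum>i\<in>UNIV. \<Sum>l\<in>UNIV. \<rho> $ (i, k) $ (i, l) * L $ l $ k)"
      by (rule sum.swap)
    also have "\<dots> = trace (reduced_snd \<rho> ** L)"
      by (simp add: trace_def matrix_matrix_mult_def reduced_snd_def sum_distrib_right,
          rule sum.cong[OF refl], rule sum.swap)
    finally show ?thesis .
  qed
  show ?thesis
    by (simp add: energy_def ham2_def matrix_add_ldistrib trace_add 1 2)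
qed

section \<open>Largest eigenvalue of the qubit marginal and the resulting population bound\<close>

lemma unitary_with_row:
  fixes w :: "complex^qubit"
  assumes "(\<Sum>i\<in>UNIV. (cmod (w $ i))\<^sup>2) = 1"
  obtains V where "unitary V" "\<And>i. V $ False $ i = cnj (w $ i)"
proof
  \<comment> \<open>The second row \<open>(- w $ True, w $ False)\<close> is orthogonal to the
    conjugate of \<open>w\<close> and has the same norm.\<close>
  let ?V = "(\<chi> r i. if r then (if i then w $ False else - w $ True) else cnj (w $ i))
      :: qubit operator"
  have w: "w $ False * cnj (w $ False) + w $ True * cnj (w $ True) = 1"
    using arg_cong[OF assms, of complex_of_real]
    by (simp add: UNIV_bool complex_norm_square del: of_real_power)
  show "unitary ?V"
    unfolding unitary_def vec_eq_iff all_bool_eq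
    using w by (simp add: matrix_matrix_mult_def adj_def mat_def UNIV_bool ac_simps)
qed simp

text \<open>The minimal population of the excited level under unitaries is the least eigenvalue of
  \<open>\<sigma>\<close>, so its complement to 1 is the largest one.\<close>
lemma expect_le_of_min_population:
  fixes \<sigma> :: "qubit operator"
  assumes tr: "trace \<sigma> = 1"
    and min: "\<And>V. unitary V \<Longrightarrow> m \<le> Re ((V ** \<sigma> ** adj V) $ True $ True)"
  shows "expect \<sigma> w \<le> (1 - m) * (\<Sum>i\<in>UNIV. (cmod (w $ i))\<^sup>2)"
proof (cases "w = 0")
  case True
  then show ?thesis by (simp add: expect_def cinner_def)
next
  case False
  define n where "n = sqrt (\<Sum>i\<in>UNIV. (cmod (w $ i))\<^sup>2)"
  have n2: "n\<^sup>2 = (\<Sum>i\<in>UNIV. (cmod (w $ i))\<^sup>2)" by (simp add: n_def sum_nonneg)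
  obtain i where "w $ i \<noteq> 0" using False by (auto simp: vec_eq_iff)
  then have "0 < (\<Sum>i\<in>UNIV. (cmod (w $ i))\<^sup>2)"
    by (intro sum_pos2[of UNIV i]) auto
  then have n: "0 < n" by (simp add: n_def)
  define v where "v = complex_of_real (1 / n) *s w"
  have "(\<Sum>i\<in>UNIV. (cmod (v $ i))\<^sup>2) = (\<Sum>i\<in>UNIV. (cmod (w $ i))\<^sup>2) / n\<^sup>2"
    using n by (simp add: v_def norm_divide power_divide sum_divide_distrib)
  also have "\<dots> = 1" using n by (simp add: n2[symmetric])
  \<comment> \<open>With this first row, \<open>expect \<sigma> v\<close> becomes the ground
    population of the rotated state.\<close>
  finally obtain V where V: "unitary V" "\<And>i. V $ False $ i = cnj (v $ i)"
    using unitary_with_row by blast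
  have "w = complex_of_real n *s v" using n by (simp add: v_def vec_eq_iff)
  then have "expect \<sigma> w = n\<^sup>2 * expect \<sigma> v"
    by (simp add: expect_def vector_scalar_commute cinner_scale_left cinner_scale_right
        power2_eq_square)
  moreover have "expect \<sigma> v = Re ((V ** \<sigma> ** adj V) $ False $ False)"
    by (simp add: conj_unitary_diag V(2))
  moreover have "\<dots> = 1 - Re ((V ** \<sigma> ** adj V) $ True $ True)"
    using arg_cong[OF trace_conj_unitary[OF V(1), of \<sigma>], of Re] tr
    by (simp add: trace_def[of "V ** \<sigma> ** adj V"] UNIV_bool)
  ultimately show ?thesis
    using min[OF V(1)] n by (simp add: n2[symmetric] mult.commute)
qed

lemma trace_reduced_fst: "trace (reduced_fst \<rho>) = trace \<rho>"
  by (simp add: trace_def reduced_fst_def sum_prod_UNIV)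

text \<open>The conjugated row \<open>r\<close> of \<open>U\<close> is a unit vector. Domination by
  the marginal bounds its expectation slice by slice, each with factor \<open>1 - m\<close>, and the
  squared slice norms add up to 1.\<close>

lemma separable_population_le:
  fixes \<rho> :: "(qubit \<times> 'b::finite) operator"
  assumes "is_state \<rho>" "separable \<rho>" "unitary U"
    and min: "\<And>V. unitary V \<Longrightarrow> m \<le> Re ((V ** reduced_fst \<rho> ** adj V) $ True $ True)"
  shows "Re ((U ** \<rho> ** adj U) $ r $ r) \<le> 1 - m"
proof -
  define u where "u = (\<chi> i. cnj (U $ r $ i))"
  have tr: "trace (reduced_fst \<rho>) = 1"
    using assms(1) by (simp add: trace_reduced_fst is_state_def)
  have "Re ((U ** \<rho> ** adj U) $ r $ r) = expect \<rho> u"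
    by (simp add: conj_unitary_diag u_def)
  also have "\<dots> \<le> (\<Sum>k\<in>UNIV. expect (reduced_fst \<rho>) (slice u k))"
    using assms(2) by (rule separable_expect_le)
  also have "\<dots> \<le> (\<Sum>k\<in>UNIV. (1 - m) * (\<Sum>i\<in>UNIV. (cmod (slice u k $ i))\<^sup>2))"
    by (intro sum_mono expect_le_of_min_population tr min)
  also have "\<dots> = (1 - m) * (\<Sum>k\<in>UNIV. \<Sum>i\<in>UNIV. (cmod (U $ r $ (i, k)))\<^sup>2)"
    by (simp add: slice_def u_def sum_distrib_left)
  also have "(\<Sum>k\<in>UNIV. \<Sum>i\<in>UNIV. (cmod (U $ r $ (i, k)))\<^sup>2) = (\<Sum>s\<in>UNIV. (cmod (U $ r $ s))\<^sup>2)"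
    unfolding sum_prod_UNIV by (rule sum.swap)
  also have "\<dots> = 1" by (rule unitary_row_norm[OF assms(3)])
  finally show ?thesis by simp
qed

section \<open>Excitation energy estimates for the two orderings of the level spacings\<close>

theorem proposition2:
  fixes E1 E2 E3 \<alpha>1 \<alpha>2 \<alpha>3 :: real
    and \<rho> :: "(qubit \<times> qubit \<times> qubit) operator"
  assumes "\<alpha>1 > 0" and "\<alpha>2 > 0" and "\<alpha>3 > 0"
    and "is_state \<rho>"
    and "separable \<rho>"
  shows "(\<alpha>1 < \<alpha>2 \<and> \<alpha>2 = \<alpha>3 \<longrightarrow>
            Delta_1_23 (qubit_ham E1 \<alpha>1) (qubit_ham E2 \<alpha>2) (qubit_ham E3 \<alpha>3) \<rho> \<le> 0) \<and>
         (\<forall>\<alpha>. \<alpha>1 = \<alpha> \<and> \<alpha>2 = \<alpha> \<and> \<alpha> > \<alpha>3 \<longrightarrow>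
            Delta_1_23 (qubit_ham E1 \<alpha>1) (qubit_ham E2 \<alpha>2) (qubit_ham E3 \<alpha>3) \<rho> \<le> (\<alpha> - \<alpha>3) / 2)"
proof -
  let ?H1 = "qubit_ham E1 \<alpha>1" and ?H2 = "qubit_ham E2 \<alpha>2" and ?H3 = "qubit_ham E3 \<alpha>3"
  obtain V where V: "unitary V"
    "\<And>U. unitary U \<Longrightarrow> energy (V ** reduced_fst \<rho> ** adj V) ?H1
        \<le> energy (U ** reduced_fst \<rho> ** adj U) ?H1"
    "ergotropy (reduced_fst \<rho>) ?H1
        = energy (reduced_fst \<rho>) ?H1 - energy (V ** reduced_fst \<rho> ** adj V) ?H1"
    using ergotropy_min_attained by blast
  obtain U where U: "unitary U"
    "ergotropy \<rho> (ham3 ?H1 ?H2 ?H3)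
        = energy \<rho> (ham3 ?H1 ?H2 ?H3) - energy (U ** \<rho> ** adj U) (ham3 ?H1 ?H2 ?H3)"
    using ergotropy_min_attained by blast
  \<comment> \<open>Since \<open>V\<close> minimizes the energy and \<open>\<alpha>1 > 0\<close>,
    this is the least excited population of the first marginal under unitaries.\<close>
  define m where "m = Re ((V ** reduced_fst \<rho> ** adj V) $ True $ True)"
  define d where "d = (\<lambda>a b c. Re ((U ** \<rho> ** adj U) $ (a, b, c) $ (a, b, c)))"
  have tr: "trace \<rho> = 1" and psd: "pos_semidef \<rho>"
    using assms(4) by (auto simp: is_state_def)
  have en1: "energy (W ** reduced_fst \<rho> ** adj W) ?H1
      = E1 + \<alpha>1 * Re ((W ** reduced_fst \<rho> ** adj W) $ True $ True)" if "unitary W" for W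
    using that by (simp add: energy_qubit_ham trace_conj_unitary trace_reduced_fst tr)
  have min: "m \<le> Re ((W ** reduced_fst \<rho> ** adj W) $ True $ True)" if "unitary W" for W
    using V(2)[OF that] assms(1) by (simp add: en1 that V(1) m_def)
  have d_le: "d a b c \<le> 1 - m" for a b c
    unfolding d_def by (rule separable_population_le[OF assms(4,5) U(1) min])
  have d_nonneg: "0 \<le> d a b c" for a b c
    using psd by (simp add: d_def conj_unitary_diag pos_semidef_def expect_def)
  have "Re (trace (U ** \<rho> ** adj U)) = 1" by (simp add: trace_conj_unitary[OF U(1)] tr)
  then have d_sum: "d False False False + d False False True + d False True False
      + d False True True + d True False False + d True False True + d True True False
      + d True True True = 1"
    by (simp add: trace_def sum_prod_UNIV UNIV_bool d_def)
  have en: "energy (U ** \<rho> ** adj U) (ham3 ?H1 ?H2 ?H3)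
      = E1 + E2 + E3 + (\<alpha>3 * d False False True + \<alpha>2 * d False True False
      + (\<alpha>2 + \<alpha>3) * d False True True + \<alpha>1 * d True False False + (\<alpha>1 + \<alpha>3) * d True False True
      + (\<alpha>1 + \<alpha>2) * d True True False + (\<alpha>1 + \<alpha>2 + \<alpha>3) * d True True True)"
  proof -
    have "energy (U ** \<rho> ** adj U) (ham3 ?H1 ?H2 ?H3) = (E1 + E2 + E3) *
      (d False False False + d False False True + d False True False
      + d False True True + d True False False + d True False True + d True True False
      + d True True True) + (\<alpha>3 * d False False True + \<alpha>2 * d False True False
      + (\<alpha>2 + \<alpha>3) * d False True True + \<alpha>1 * d True False False + (\<alpha>1 + \<alpha>3) * d True False True
      + (\<alpha>1 + \<alpha>2) * d True True False + (\<alpha>1 + \<alpha>2 + \<alpha>3) * d True True True)"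
      unfolding ham3_eq_ham2
      by (subst energy_diag[OF ham2_diag[OF qubit_ham_nth ham2_diag[OF qubit_ham_nth qubit_ham_nth]]])
        (simp add: sum_prod_UNIV UNIV_bool d_def algebra_simps)
    then show ?thesis by (simp add: d_sum)
  qed
  \<comment> \<open>The energies of \<open>\<rho>\<close> and its marginals cancel by additivity,
    and so do the offsets \<open>E1\<close>, \<open>E2\<close>, \<open>E3\<close>.\<close>
  have Delta: "Delta_1_23 ?H1 ?H2 ?H3 \<rho> = \<alpha>1 * m - (\<alpha>3 * d False False True
      + \<alpha>2 * d False True False
      + (\<alpha>2 + \<alpha>3) * d False True True + \<alpha>1 * d True False False + (\<alpha>1 + \<alpha>3) * d True False True
      + (\<alpha>1 + \<alpha>2) * d True True False + (\<alpha>1 + \<alpha>2 + \<alpha>3) * d True True True)"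
    unfolding Delta_1_23_def U(2) V(3) en en1[OF V(1)] ground_energy_ham2[OF assms(2,3)]
    by (simp add: ham3_eq_ham2 energy_ham2 m_def)
  have scaled: "x * d a b c \<le> y * d a b c" if "x \<le> y" for x y a b c
    using that d_nonneg by (rule mult_right_mono)
  \<comment> \<open>Normalization multiplied by \<open>\<alpha>1\<close>, so that linear arithmetic
    can treat the products as atoms.\<close>
  have sum_scaled: "\<alpha>1 * (d False False False + d False False True + d False True False
      + d False True True + d True False False + d True False True + d True True False
      + d True True True) = \<alpha>1"
    by (simp only: d_sum mult_1_right)
  show ?thesis
  proof (intro conjI allI impI)
    assume "\<alpha>1 < \<alpha>2 \<and> \<alpha>2 = \<alpha>3"
    then have "\<alpha>1 * (1 - d False False False) \<le> \<alpha>3 * d False False True + \<alpha>2 * d False True False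
      + (\<alpha>2 + \<alpha>3) * d False True True + \<alpha>1 * d True False False + (\<alpha>1 + \<alpha>3) * d True False True
      + (\<alpha>1 + \<alpha>2) * d True True False + (\<alpha>1 + \<alpha>2 + \<alpha>3) * d True True True"
      using scaled[of \<alpha>1 \<alpha>3 False False True] scaled[of \<alpha>1 \<alpha>2 False True False]
        scaled[of \<alpha>1 "\<alpha>2 + \<alpha>3" False True True] scaled[of \<alpha>1 "\<alpha>1 + \<alpha>3" True False True]
        scaled[of \<alpha>1 "\<alpha>1 + \<alpha>2" True True False] scaled[of \<alpha>1 "\<alpha>1 + \<alpha>2 + \<alpha>3" True True True]
        sum_scaled assms(1-3)
      unfolding right_diff_distrib distrib_left by linarith
    moreover have "\<alpha>1 * m \<le> \<alpha>1 * (1 - d False False False)"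
      using d_le[of False False False] assms(1) by (intro mult_left_mono) auto
    ultimately show "Delta_1_23 ?H1 ?H2 ?H3 \<rho> \<le> 0" unfolding Delta by linarith
  next
    fix \<alpha> assume "\<alpha>1 = \<alpha> \<and> \<alpha>2 = \<alpha> \<and> \<alpha> > \<alpha>3"
    then have \<alpha>: "\<alpha>1 = \<alpha>" "\<alpha>2 = \<alpha>" "\<alpha>3 < \<alpha>" by auto
    let ?p = "d False False False" and ?q = "d False False True"
    \<comment> \<open>Levels 010 and 100 cost exactly \<open>\<alpha>\<close>, and 001 falls short
      of it by \<open>\<alpha> - \<alpha>3\<close>.\<close>
    have "\<alpha> * (1 - ?p) - (\<alpha> - \<alpha>3) * ?q \<le> \<alpha>3 * ?q + \<alpha>2 * d False True False
      + (\<alpha>2 + \<alpha>3) * d False True True + \<alpha>1 * d True False False + (\<alpha>1 + \<alpha>3) * d True False True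
      + (\<alpha>1 + \<alpha>2) * d True True False + (\<alpha>1 + \<alpha>2 + \<alpha>3) * d True True True"
      using scaled[of \<alpha>1 "\<alpha>2 + \<alpha>3" False True True] scaled[of \<alpha>1 "\<alpha>1 + \<alpha>3" True False True]
        scaled[of \<alpha>1 "\<alpha>1 + \<alpha>2" True True False] scaled[of \<alpha>1 "\<alpha>1 + \<alpha>2 + \<alpha>3" True True True]
        sum_scaled assms(1-3)
      unfolding \<alpha>(1,2) right_diff_distrib left_diff_distrib distrib_left by linarith
    then have bound: "Delta_1_23 ?H1 ?H2 ?H3 \<rho> \<le> \<alpha> * m - \<alpha> * (1 - ?p) + (\<alpha> - \<alpha>3) * ?q"
      unfolding Delta unfolding \<alpha>(1,2) by linarith
    have pq: "?p + ?q \<le> 1"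
      using d_sum d_nonneg[of False True False] d_nonneg[of False True True]
        d_nonneg[of True False False] d_nonneg[of True False True] d_nonneg[of True True False]
        d_nonneg[of True True True] by linarith
    \<comment> \<open>The population bound is used for both 000 and 001, as either may be
      larger.\<close>
    have "\<alpha> * m \<le> \<alpha> * (1 - max ?p ?q)"
      using d_le[of False False False] d_le[of False False True] assms(1) \<alpha>(1)
      by (intro mult_left_mono) auto
    then have "\<alpha> * m - \<alpha> * (1 - ?p) + (\<alpha> - \<alpha>3) * ?q \<le> (\<alpha> - \<alpha>3) * min ?p ?q"
    proof (cases "?p \<le> ?q")
      case True
      \<comment> \<open>Here \<open>m \<le> 1 - ?q\<close> bounds the left side by
        \<open>\<alpha> * ?p - \<alpha>3 * ?q\<close>; in the other case
        \<open>m \<le> 1 - ?p\<close> removes the first two terms.\<close>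
      then have "\<alpha>3 * ?p \<le> \<alpha>3 * ?q" using assms(3) by simp
      with \<open>\<alpha> * m \<le> _\<close> True show ?thesis by (simp add: max_def min_def algebra_simps)
    next
      case False
      with \<open>\<alpha> * m \<le> _\<close> show ?thesis by (simp add: max_def min_def algebra_simps)
    qed
    also have "\<dots> \<le> (\<alpha> - \<alpha>3) * (1 / 2)"
      using pq \<alpha>(3) by (intro mult_left_mono) auto
    finally show "Delta_1_23 ?H1 ?H2 ?H3 \<rho> \<le> (\<alpha> - \<alpha>3) / 2" using bound by simp
  qed
qed

end
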